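(* Let $\operatorname{Dend}$ be the non-symmetric dendriform operad over $\mathbb{Q}$. Let $\tau_1$ be multiplication by $-1$ on $\operatorname{Dend}(1)$ and let $\tau_2$ be the endomorphism of $\operatorname{Dend}(2)$ given by $\tau_2(x_1\succ x_2)=x_1\prec x_2$ and $\tau_2(x_1\prec x_2)=-\,x_1\prec x_2-x_1\succ x_2$. Then there exists a unique collection $\tau=(\tau_n)_{n\ge1}$ of endomorphisms $\tau_n$ of the spaces $\operatorname{Dend}(n)$ which extends $\tau_1$ and $\tau_2$ and endows the operad $\operatorname{Dend}$ with a structure of non-symmetric anticyclic operad.
   Context: All vector spaces are over $\mathbb{Q}$. The non-symmetric operad $\operatorname{Dend}$ is generated by two binary operations $x\prec y$ and $x\succ y$ subject to the relations $(x\prec y)\prec z=x\prec(y\prec z)+x\prec(y\succ z)$, $x\succ(y\prec z)=(x\succ y)\prec z$, $x\succ(y\succ z)=(x\succ y)\succ z+(x\prec y)\succ z$. A non-symmetric anticyclic operad is a non-symmetric operad $\mathcal{P}$ (with unit $1\in\mathcal{P}(1)$ and partial compositions $\circ_i$) together with endomorphisms $\tau_n$ of $\mathcal{P}(n)$, $n\ge1$, such that $\tau_n^{n+1}=\mathrm{Id}$ (an action of the cyclic group of order $n+1$ on $\mathcal P(n)$), $\tau_1(1)=-1$, and for $f\in\mathcal{P}(m)$, $g\in\mathcal{P}(n)$: $\tau_{m+n-1}(f\circ_i g)=\tau_m(f)\circ_{i-1}g$ for $2\le i\le m$, and $\tau_{m+n-1}(f\circ_1 g)=-\tau_n(g)\circ_n\tau_m(f)$.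 The map $\tau_2$ is the one obtained from the rule $\langle E(x,y),z\rangle=\langle\tau_2(E)(y,z),x\rangle$ for an antisymmetric bilinear map $\langle\,,\rangle$ satisfying $\langle x\succ y,z\rangle=\langle y\prec z,x\rangle$ and $\langle x\prec y,z\rangle=-\langle y\prec z,x\rangle-\langle y\succ z,x\rangle$. *)

theory Defs
  imports Complex_Main "HOL-Library.Poly_Mapping" "HOL-Library.FuncSet"
begin

section \<open>Non-symmetric (anticyclic) operads over the rationals\<close>

text \<open>
  The spaces \<open>P n\<close> are subspaces of one ambient rational vector space; an arbitrary operad is
  of this form, the ambient space being the direct sum of its components. The composite
  \<open>f \<circ>\<^bsub>i\<^esub> g\<close> is meaningful only for \<open>f \<in> P m\<close>, \<open>g \<in> P n\<close> and \<open>1 \<le> i \<le> m\<close>.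
\<close>

locale ns_operad = vector_space scale
  for scale :: "rat \<Rightarrow> 'a::ab_group_add \<Rightarrow> 'a" +
  fixes P :: "nat \<Rightarrow> 'a set"
    and pcomp :: "'a \<Rightarrow> nat \<Rightarrow> 'a \<Rightarrow> 'a"  ("_ \<circ>\<^bsub>_\<^esub> _" [71, 0, 71] 70)
    and unit :: 'a
  assumes subspace_P: "subspace (P n)"
    and unit_mem: "unit \<in> P 1"
    and pcomp_mem: "\<lbrakk>f \<in> P m; g \<in> P n; 1 \<le> i; i \<le> m\<rbrakk> \<Longrightarrow> f \<circ>\<^bsub>i\<^esub> g \<in> P (m + n - 1)"
    and pcomp_add_left: "\<lbrakk>f \<in> P m; f' \<in> P m; g \<in> P n; 1 \<le> i; i \<le> m\<rbrakk> \<Longrightarrow>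
          (f + f') \<circ>\<^bsub>i\<^esub> g = f \<circ>\<^bsub>i\<^esub> g + f' \<circ>\<^bsub>i\<^esub> g"
    and pcomp_add_right: "\<lbrakk>f \<in> P m; g \<in> P n; g' \<in> P n; 1 \<le> i; i \<le> m\<rbrakk> \<Longrightarrow>
          f \<circ>\<^bsub>i\<^esub> (g + g') = f \<circ>\<^bsub>i\<^esub> g + f \<circ>\<^bsub>i\<^esub> g'"
    and pcomp_scale_left: "\<lbrakk>f \<in> P m; g \<in> P n; 1 \<le> i; i \<le> m\<rbrakk> \<Longrightarrow>
          scale c f \<circ>\<^bsub>i\<^esub> g = scale c (f \<circ>\<^bsub>i\<^esub> g)"
    and pcomp_scale_right: "\<lbrakk>f \<in> P m; g \<in> P n; 1 \<le> i; i \<le> m\<rbrakk> \<Longrightarrow>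
          f \<circ>\<^bsub>i\<^esub> scale c g = scale c (f \<circ>\<^bsub>i\<^esub> g)"
    and unit_left: "f \<in> P n \<Longrightarrow> unit \<circ>\<^bsub>1\<^esub> f = f"
    and unit_right: "\<lbrakk>f \<in> P m; 1 \<le> i; i \<le> m\<rbrakk> \<Longrightarrow> f \<circ>\<^bsub>i\<^esub> unit = f"
    and assoc_sequential:
      "\<lbrakk>f \<in> P l; g \<in> P m; h \<in> P n; 1 \<le> i; i \<le> l; 1 \<le> j; j \<le> m\<rbrakk> \<Longrightarrow>
          f \<circ>\<^bsub>i\<^esub> (g \<circ>\<^bsub>j\<^esub> h) = (f \<circ>\<^bsub>i\<^esub> g) \<circ>\<^bsub>i + j - 1\<^esub> h"
    and assoc_parallel:
      "\<lbrakk>f \<in> P l; g \<in> P m; h \<in> P n; 1 \<le> i; i < k; k \<le> l\<rbrakk> \<Longrightarrow>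
          (f \<circ>\<^bsub>i\<^esub> g) \<circ>\<^bsub>k + m - 1\<^esub> h = (f \<circ>\<^bsub>k\<^esub> h) \<circ>\<^bsub>i\<^esub> g"

locale ns_anticyclic_operad = ns_operad scale P pcomp unit
  for scale :: "rat \<Rightarrow> 'a::ab_group_add \<Rightarrow> 'a"
    and P :: "nat \<Rightarrow> 'a set"
    and pcomp :: "'a \<Rightarrow> nat \<Rightarrow> 'a \<Rightarrow> 'a"  ("_ \<circ>\<^bsub>_\<^esub> _" [71, 0, 71] 70)
    and unit :: 'a +
  fixes \<tau> :: "nat \<Rightarrow> 'a \<Rightarrow> 'a"
  assumes tau_mem: "\<lbrakk>n \<ge> 1; f \<in> P n\<rbrakk> \<Longrightarrow> \<tau> n f \<in> P n"
    and tau_add: "\<lbrakk>n \<ge> 1; f \<in> P n; g \<in> P n\<rbrakk> \<Longrightarrow> \<tau> n (f + g) = \<tau> n f + \<tau> n g"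
    and tau_scale: "\<lbrakk>n \<ge> 1; f \<in> P n\<rbrakk> \<Longrightarrow> \<tau> n (scale c f) = scale c (\<tau> n f)"
    and tau_order: "\<lbrakk>n \<ge> 1; f \<in> P n\<rbrakk> \<Longrightarrow> (\<tau> n ^^ (n + 1)) f = f"
    and tau_unit: "\<tau> 1 unit = - unit"
    and tau_pcomp: "\<lbrakk>m \<ge> 1; n \<ge> 1; f \<in> P m; g \<in> P n; 2 \<le> i; i \<le> m\<rbrakk> \<Longrightarrow>
          \<tau> (m + n - 1) (f \<circ>\<^bsub>i\<^esub> g) = \<tau> m f \<circ>\<^bsub>i - 1\<^esub> g"
    and tau_pcomp_1: "\<lbrakk>m \<ge> 1; n \<ge> 1; f \<in> P m; g \<in> P n\<rbrakk> \<Longrightarrow>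
          \<tau> (m + n - 1) (f \<circ>\<^bsub>1\<^esub> g) = - (\<tau> n g \<circ>\<^bsub>n\<^esub> \<tau> m f)"


section \<open>The free non-symmetric operad on a set of binary operations\<close>

text \<open>
  A basis of its component of arity \<open>n\<close> is given by the planar binary trees with \<open>n\<close> leaves
  whose inner vertices are labelled by the generators. The type \<open>'g tree \<Rightarrow>\<^sub>0 rat\<close> of finite
  formal combinations of such trees is the direct sum of all components.
\<close>

datatype 'g tree = Leaf | Node 'g "'g tree" "'g tree"

fun leaves :: "'g tree \<Rightarrow> nat" where
  "leaves Leaf = 1"
| "leaves (Node g l r) = leaves l + leaves r"

text \<open>Replace the \<open>i\<close>-th leaf (from the left, starting with 1) of the first tree by the second.\<close>

fun graft :: "'g tree \<Rightarrow> nat \<Rightarrow> 'g tree \<Rightarrow> 'g tree" where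
  "graft Leaf i t = t"
| "graft (Node g l r) i t =
     (if i \<le> leaves l then Node g (graft l i t) r else Node g l (graft r (i - leaves l) t))"

abbreviation basis :: "'g tree \<Rightarrow> 'g tree \<Rightarrow>\<^sub>0 rat" where
  "basis t \<equiv> Poly_Mapping.single t 1"

definition free_part :: "nat \<Rightarrow> ('g tree \<Rightarrow>\<^sub>0 rat) set" where
  "free_part n = {p. \<forall>t \<in> Poly_Mapping.keys p. leaves t = n}"

definition free_scale :: "rat \<Rightarrow> ('g tree \<Rightarrow>\<^sub>0 rat) \<Rightarrow> 'g tree \<Rightarrow>\<^sub>0 rat" where
  "free_scale c p = Poly_Mapping.map ((*) c) p"

text \<open>
  Bilinear extension of \<^const>\<open>graft\<close>. Terms whose arity does not allow the composition
  at \<open>i\<close> contribute 0, so that the operation is defined on the whole direct sum.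
\<close>

definition free_comp ::
    "('g tree \<Rightarrow>\<^sub>0 rat) \<Rightarrow> nat \<Rightarrow> ('g tree \<Rightarrow>\<^sub>0 rat) \<Rightarrow> 'g tree \<Rightarrow>\<^sub>0 rat" where
  "free_comp p i q =
     (\<Sum>s \<in> Poly_Mapping.keys p. \<Sum>t \<in> Poly_Mapping.keys q.
        if 1 \<le> i \<and> i \<le> leaves s
        then Poly_Mapping.single (graft s i t) (Poly_Mapping.lookup p s * Poly_Mapping.lookup q t)
        else 0)"

text \<open>
  The operadic ideal generated by \<open>R\<close>. If \<open>R\<close> consists of homogeneous elements, this is the
  direct sum of the components of the operadic ideal in the usual (arity-wise) sense.
\<close>

inductive_set operadic_ideal :: "('g tree \<Rightarrow>\<^sub>0 rat) set \<Rightarrow> ('g tree \<Rightarrow>\<^sub>0 rat) set"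
  for R :: "('g tree \<Rightarrow>\<^sub>0 rat) set" where
  ideal_gen: "r \<in> R \<Longrightarrow> r \<in> operadic_ideal R"
| ideal_zero: "0 \<in> operadic_ideal R"
| ideal_add: "\<lbrakk>p \<in> operadic_ideal R; q \<in> operadic_ideal R\<rbrakk> \<Longrightarrow> p + q \<in> operadic_ideal R"
| ideal_scale: "p \<in> operadic_ideal R \<Longrightarrow> free_scale c p \<in> operadic_ideal R"
| ideal_comp_left: "p \<in> operadic_ideal R \<Longrightarrow> free_comp p i q \<in> operadic_ideal R"
| ideal_comp_right: "q \<in> operadic_ideal R \<Longrightarrow> free_comp p i q \<in> operadic_ideal R"

lemma lookup_free_scale [simp]:
  "Poly_Mapping.lookup (free_scale c p) t = c * Poly_Mapping.lookup p t"
  unfolding free_scale_def by transfer (simp add: when_def)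

lemma free_scale_minus_one: "free_scale (- 1) p = - p"
  by (rule poly_mapping_eqI) simp

lemma free_scale_diff: "free_scale c p - free_scale c q = free_scale c (p - q)"
  by (rule poly_mapping_eqI) (simp add: lookup_minus algebra_simps)

lemma ideal_uminus: "p \<in> operadic_ideal R \<Longrightarrow> - p \<in> operadic_ideal R"
  using ideal_scale[of p R "- 1"] by (simp add: free_scale_minus_one)

lemma ideal_diff:
  "\<lbrakk>p \<in> operadic_ideal R; q \<in> operadic_ideal R\<rbrakk> \<Longrightarrow> p - q \<in> operadic_ideal R"
  using ideal_add[of p R "- q"] ideal_uminus[of q R] by simp

lemma free_comp_superset:
  assumes "finite A" "finite B" "Poly_Mapping.keys p \<subseteq> A" "Poly_Mapping.keys q \<subseteq> B"
  shows "free_comp p i q =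
     (\<Sum>s\<in>A. \<Sum>t\<in>B. if 1 \<le> i \<and> i \<le> leaves s
        then Poly_Mapping.single (graft s i t) (Poly_Mapping.lookup p s * Poly_Mapping.lookup q t)
        else 0)"
proof -
  have "free_comp p i q = (\<Sum>s \<in> Poly_Mapping.keys p. \<Sum>t\<in>B. if 1 \<le> i \<and> i \<le> leaves s
        then Poly_Mapping.single (graft s i t) (Poly_Mapping.lookup p s * Poly_Mapping.lookup q t)
        else 0)"
    unfolding free_comp_def using assms
    by (intro sum.cong refl sum.mono_neutral_left) (auto simp: in_keys_iff)
  also have "\<dots> = (\<Sum>s\<in>A. \<Sum>t\<in>B. if 1 \<le> i \<and> i \<le> leaves s
        then Poly_Mapping.single (graft s i t) (Poly_Mapping.lookup p s * Poly_Mapping.lookup q t)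
        else 0)"
    using assms by (intro sum.mono_neutral_left) (auto simp: in_keys_iff intro!: sum.neutral)
  finally show ?thesis .
qed

lemma free_comp_diff_left: "free_comp (p - p') i q = free_comp p i q - free_comp p' i q"
proof -
  let ?A = "Poly_Mapping.keys p \<union> Poly_Mapping.keys p'"
  let ?B = "Poly_Mapping.keys q"
  have A: "finite ?A" "finite ?B" by auto
  have "Poly_Mapping.keys (p - p') \<subseteq> ?A" by (auto simp: in_keys_iff lookup_minus)
  then show ?thesis
    by (simp add: free_comp_superset[OF A] sum_subtractf[symmetric] single_diff[symmetric]
        lookup_minus left_diff_distrib if_distrib[where f = "\<lambda>x. x - _"] cong: if_cong)
qed

lemma free_comp_diff_right: "free_comp p i (q - q') = free_comp p i q - free_comp p i q'"
proof -
  let ?A = "Poly_Mapping.keys p"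
  let ?B = "Poly_Mapping.keys q \<union> Poly_Mapping.keys q'"
  have A: "finite ?A" "finite ?B" by auto
  have "Poly_Mapping.keys (q - q') \<subseteq> ?B" by (auto simp: in_keys_iff lookup_minus)
  then show ?thesis
    by (simp add: free_comp_superset[OF A] sum_subtractf[symmetric] single_diff[symmetric]
        lookup_minus right_diff_distrib if_distrib[where f = "\<lambda>x. x - _"] cong: if_cong)
qed


section \<open>The dendriform operad\<close>

datatype dend_gen = Prec | Succ

definition dend_relations :: "(dend_gen tree \<Rightarrow>\<^sub>0 rat) set" where
  "dend_relations =
    {basis (Node Prec (Node Prec Leaf Leaf) Leaf)
       - (basis (Node Prec Leaf (Node Prec Leaf Leaf))
          + basis (Node Prec Leaf (Node Succ Leaf Leaf))),
     basis (Node Succ Leaf (Node Prec Leaf Leaf))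
       - basis (Node Prec (Node Succ Leaf Leaf) Leaf),
     basis (Node Succ Leaf (Node Succ Leaf Leaf))
       - (basis (Node Succ (Node Succ Leaf Leaf) Leaf)
          + basis (Node Succ (Node Prec Leaf Leaf) Leaf))}"

definition dend_rel :: "(dend_gen tree \<Rightarrow>\<^sub>0 rat) \<Rightarrow> (dend_gen tree \<Rightarrow>\<^sub>0 rat) \<Rightarrow> bool" where
  "dend_rel p q \<longleftrightarrow> p - q \<in> operadic_ideal dend_relations"

lemma equivp_dend_rel: "equivp dend_rel"
proof (rule equivpI)
  show "reflp dend_rel"
    by (simp add: reflp_def dend_rel_def ideal_zero)
  show "symp dend_rel"
    unfolding symp_def dend_rel_def by (metis ideal_uminus minus_diff_eq)
  show "transp dend_rel"
    unfolding transp_def dend_rel_def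
    by (metis (no_types, lifting) ideal_add add_diff_eq diff_add_cancel)
qed

text \<open>The direct sum of all the spaces \<open>Dend n\<close>.\<close>

quotient_type dend = "dend_gen tree \<Rightarrow>\<^sub>0 rat" / dend_rel
  by (rule equivp_dend_rel)

instantiation dend :: ab_group_add
begin

lift_definition zero_dend :: dend is 0 .

lift_definition plus_dend :: "dend \<Rightarrow> dend \<Rightarrow> dend" is "(+)"
  unfolding dend_rel_def by (metis add_diff_add ideal_add)

lift_definition uminus_dend :: "dend \<Rightarrow> dend" is uminus
  unfolding dend_rel_def by (metis ideal_uminus minus_diff_minus)

lift_definition minus_dend :: "dend \<Rightarrow> dend \<Rightarrow> dend" is "(-)"
proof -
  fix p p' q q' assume "dend_rel p p'" "dend_rel q q'"
  moreover have "p - q - (p' - q') = (p - p') - (q - q')" by simp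
  ultimately show "dend_rel (p - q) (p' - q')"
    unfolding dend_rel_def by (metis ideal_diff)
qed

instance
proof
  fix a b c :: dend
  show "a + b + c = a + (b + c)"
    by transfer (simp add: equivp_reflp[OF equivp_dend_rel] add.assoc)
  show "a + b = b + a"
    by transfer (simp add: equivp_reflp[OF equivp_dend_rel] add.commute)
  show "0 + a = a"
    by transfer (simp add: equivp_reflp[OF equivp_dend_rel])
  show "- a + a = 0"
    by transfer (simp add: equivp_reflp[OF equivp_dend_rel])
  show "a - b = a + - b"
    by transfer (simp add: equivp_reflp[OF equivp_dend_rel])
qed

end

lift_definition dend_scale :: "rat \<Rightarrow> dend \<Rightarrow> dend" is free_scale
  unfolding dend_rel_def by (simp add: free_scale_diff ideal_scale)

lift_definition dend_comp :: "dend \<Rightarrow> nat \<Rightarrow> dend \<Rightarrow> dend" is free_comp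
proof -
  fix p p' q q' :: "dend_gen tree \<Rightarrow>\<^sub>0 rat" and i
  assume *: "dend_rel p p'" "dend_rel q q'"
  have "free_comp p i q - free_comp p' i q' = free_comp (p - p') i q + free_comp p' i (q - q')"
    by (simp add: free_comp_diff_left free_comp_diff_right)
  with * show "dend_rel (free_comp p i q) (free_comp p' i q')"
    unfolding dend_rel_def by (simp add: ideal_add ideal_comp_left ideal_comp_right)
qed

lift_definition dend_unit :: dend is "basis Leaf" .

lift_definition dend_prec :: dend is "basis (Node Prec Leaf Leaf)" .

lift_definition dend_succ :: dend is "basis (Node Succ Leaf Leaf)" .

definition Dend :: "nat \<Rightarrow> dend set" where
  "Dend n = abs_dend ` free_part n"

end

theory Submission
  imports Defs
begin

text \<open>
  Every labelled binary tree other than a leaf is a composite of smaller ones,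
  \<open>Node g l r = (g \<circ>\<^bsub>2\<^esub> r) \<circ>\<^bsub>1\<^esub> l\<close>, where \<open>g\<close> also denotes the corolla of the generator \<open>g\<close>.
  In an anticyclic operad this forces \<open>\<tau> (Node g l r) = - (\<tau> l \<circ>\<^bsub>n\<^esub> (\<tau> g \<circ>\<^bsub>1\<^esub> r))\<close>, where \<open>n\<close> is the
  number of leaves of \<open>l\<close>. Hence \<open>\<tau>\<close> is determined on all trees, and so on the linear span of their
  classes, by its values on the unit and on the generators; this is uniqueness
  (\<open>anticyclic_Dend_unique\<close>).

  For existence, take the same formula as a recursive definition of an endomorphism of the free
  operad, for arbitrary values in arity 2 on the generators (locale \<open>tree_rotation\<close>). Both composition
  rules then follow by induction on the outer tree, from the two associativity laws alone
  (\<open>rotate_tree_graft\<close>, \<open>rotate_tree_graft_1\<close>). They also yield the order: applying the endomorphism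
  \<open>m + n\<close> times to \<open>f \<circ>\<^bsub>i\<^esub> g\<close>, with \<open>f\<close> of arity \<open>m\<close> and \<open>g\<close> of arity \<open>n\<close>, carries \<open>f\<close> through
  \<open>m + 1\<close> steps and \<open>g\<close> through \<open>n + 1\<close> steps, exchanging their places twice, so that the two signs
  cancel (\<open>rotate_order_comp\<close>). Thus the order condition need only be checked on the generators.

  The endomorphism descends to the quotient by an operadic ideal as soon as it maps the homogeneous
  relations that generate the ideal into it (\<open>rotate_ideal\<close>). For the three dendriform relations
  \<open>R1, R2, R3\<close> (each read as left side minus right side) one computes
  \<open>R1 \<mapsto> R1 - R2 - R3\<close>, \<open>R2 \<mapsto> R1\<close>, \<open>R3 \<mapsto> - R2\<close> (\<open>dend_rotate_relation\<close>).
\<close>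

section \<open>Grafting of trees\<close>

lemma leaves_pos [simp]: "1 \<le> leaves t" "0 < leaves t" "leaves t \<noteq> 0" "Suc 0 \<le> leaves t"
  by (induction t) auto

lemma leaves_graft:
  "\<lbrakk>1 \<le> i; i \<le> leaves s\<rbrakk> \<Longrightarrow> leaves (graft s i t) = leaves s + leaves t - 1"
proof (induction s arbitrary: i)
  case (Node g l r)
  show ?case
  proof (cases "i \<le> leaves l")
    case True
    moreover have "leaves l + leaves t - 1 + leaves r = leaves l + leaves r + leaves t - 1"
      using leaves_pos(1)[of l] by linarith
    ultimately show ?thesis using Node by simp
  next
    case False
    with Node.prems have "1 \<le> i - leaves l" "i - leaves l \<le> leaves r" by auto
    moreover have "leaves l + (leaves r + leaves t - 1) = leaves l + leaves r + leaves t - 1"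
      using leaves_pos(1)[of r] by linarith
    ultimately show ?thesis using Node.IH(2) False by simp
  qed
qed simp

lemma graft_Leaf_right: "\<lbrakk>1 \<le> i; i \<le> leaves s\<rbrakk> \<Longrightarrow> graft s i Leaf = s"
  by (induction s arbitrary: i) auto

lemma graft_sequential:
  "\<lbrakk>1 \<le> i; i \<le> leaves s; 1 \<le> j; j \<le> leaves t\<rbrakk> \<Longrightarrow>
     graft s i (graft t j u) = graft (graft s i t) (i + j - 1) u"
proof (induction s arbitrary: i)
  case (Node g l r)
  show ?case
  proof (cases "i \<le> leaves l")
    case True
    with Node.prems have "i + j - 1 \<le> leaves l + leaves t - 1" by linarith
    with True Node show ?thesis by (simp add: leaves_graft)
  next
    case False
    with Node.prems have i: "1 \<le> i - leaves l" "i - leaves l \<le> leaves r" by auto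
    have "i + j - 1 - leaves l = i - leaves l + j - 1" "\<not> i + j - 1 \<le> leaves l"
      using False Node.prems by linarith+
    with Node.IH(2)[OF i Node.prems(3,4)] False Node.prems show ?thesis by simp
  qed
qed simp

lemma graft_parallel:
  "\<lbrakk>1 \<le> i; i < k; k \<le> leaves s\<rbrakk> \<Longrightarrow>
     graft (graft s i t) (k + leaves t - 1) u = graft (graft s k u) i t"
proof (induction s arbitrary: i k)
  case (Node g l r)
  consider "k \<le> leaves l" | "i \<le> leaves l" "leaves l < k" | "leaves l < i"
    by linarith
  then show ?case
  proof cases
    case 1
    then have "k + leaves t - 1 \<le> leaves l + leaves t - 1" "i \<le> leaves l + leaves u - 1"
      using leaves_pos(1)[of u] Node.prems by linarith+
    with 1 Node.IH(1)[of i k] Node.prems show ?thesis by (simp add: leaves_graft)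
  next
    case 2
    then have "\<not> k + leaves t - 1 \<le> leaves l + leaves t - 1"
      "k + leaves t - 1 - (leaves l + leaves t - 1) = k - leaves l"
      using leaves_pos(1)[of t] by linarith+
    with 2 Node.prems show ?thesis by (simp add: leaves_graft)
  next
    case 3
    then have "\<not> k + leaves t - 1 \<le> leaves l"
      "k + leaves t - 1 - leaves l = k - leaves l + leaves t - 1"
      using leaves_pos(1)[of t] Node.prems by linarith+
    with 3 Node.IH(2)[of "i - leaves l" "k - leaves l"] Node.prems
    show ?thesis by simp
  qed
qed simp


section \<open>The free operad\<close>

lemma free_scale_simps [simp]:
  "free_scale c 0 = 0"
  "free_scale 0 p = 0"
  "free_scale 1 p = p"
  "free_scale c (- p) = - free_scale c p"
  "free_scale c (p + q) = free_scale c p + free_scale c q"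
  "free_scale a (free_scale b p) = free_scale (a * b) p"
  by (rule poly_mapping_eqI; simp add: lookup_add algebra_simps)+

lemma free_scale_add_scalar: "free_scale (a + b) p = free_scale a p + free_scale b p"
  by (rule poly_mapping_eqI) (simp add: lookup_add algebra_simps)

lemma free_scale_single [simp]:
  "free_scale c (Poly_Mapping.single t d) = Poly_Mapping.single t (c * d)"
  by (rule poly_mapping_eqI) (simp add: lookup_single when_def)

lemma free_scale_sum: "free_scale c (sum f A) = (\<Sum>a\<in>A. free_scale c (f a))"
  by (induction A rule: infinite_finite_induct) auto

lemma free_comp_zero [simp]: "free_comp 0 i q = 0" "free_comp p i 0 = 0"
  by (simp_all add: free_comp_def)

lemma free_comp_uminus_left [simp]: "free_comp (- p) i q = - free_comp p i q"
  using free_comp_diff_left[of 0 p i q] by simp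

lemma free_comp_uminus_right [simp]: "free_comp p i (- q) = - free_comp p i q"
  using free_comp_diff_right[of p i 0 q] by simp

lemma free_comp_add_left [simp]: "free_comp (p + p') i q = free_comp p i q + free_comp p' i q"
  using free_comp_diff_left[of p "- p'" i q] by simp

lemma free_comp_add_right [simp]: "free_comp p i (q + q') = free_comp p i q + free_comp p i q'"
  using free_comp_diff_right[of p i q "- q'"] by simp

lemma keys_free_scale: "Poly_Mapping.keys (free_scale c p) \<subseteq> Poly_Mapping.keys p"
  by (auto simp: in_keys_iff)

lemma free_comp_scale_left [simp]: "free_comp (free_scale c p) i q = free_scale c (free_comp p i q)"
  unfolding free_comp_superset[OF finite_keys finite_keys keys_free_scale order.refl]
  by (auto simp: free_comp_def free_scale_sum mult.assoc
      intro!: sum.cong)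

lemma free_comp_scale_right [simp]: "free_comp p i (free_scale c q) = free_scale c (free_comp p i q)"
  unfolding free_comp_superset[OF finite_keys finite_keys order.refl keys_free_scale]
  by (auto simp: free_comp_def free_scale_sum mult_ac
      intro!: sum.cong)

lemma free_comp_basis:
  "free_comp (basis s) i (basis t) =
     (if 1 \<le> i \<and> i \<le> leaves s then basis (graft s i t) else 0)"
  unfolding free_comp_def by (cases "1 \<le> i \<and> i \<le> leaves s") auto

lemma free_part_zero [simp]: "0 \<in> free_part n"
  and free_part_add [simp]: "\<lbrakk>p \<in> free_part n; q \<in> free_part n\<rbrakk> \<Longrightarrow> p + q \<in> free_part n"
  and free_part_scale [simp]: "p \<in> free_part n \<Longrightarrow> free_scale c p \<in> free_part n"
  and free_part_uminus [simp]: "p \<in> free_part n \<Longrightarrow> - p \<in> free_part n"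
  and basis_in_free_part [simp]: "basis t \<in> free_part n \<longleftrightarrow> leaves t = n"
  using keys_add[of p q] keys_free_scale[of c p] by (auto simp: free_part_def)

lemma free_part_diff [simp]: "\<lbrakk>p \<in> free_part n; q \<in> free_part n\<rbrakk> \<Longrightarrow> p - q \<in> free_part n"
  using free_part_add[of p n "- q"] by simp

lemma free_induct_keys:
  assumes "Q 0" "\<And>p q. Q p \<Longrightarrow> Q q \<Longrightarrow> Q (p + q)" "\<And>c p. Q p \<Longrightarrow> Q (free_scale c p)"
    and "\<And>t. t \<in> Poly_Mapping.keys p \<Longrightarrow> Q (basis t)"
  shows "Q p"
proof -
  have "Q (\<Sum>t\<in>A. free_scale (Poly_Mapping.lookup p t) (basis t))"
    if "finite A" "A \<subseteq> Poly_Mapping.keys p" for A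
    using that by (induction A rule: finite_induct) (auto simp del: free_scale_single intro!: assms)
  moreover have "(\<Sum>t\<in>Poly_Mapping.keys p. free_scale (Poly_Mapping.lookup p t) (basis t)) = p"
    by (rule poly_mapping_eqI) (simp add: lookup_sum lookup_single when_def in_keys_iff)
  ultimately show ?thesis by (metis finite_keys order.refl)
qed

text \<open>
  Linear and multilinear identities are checked on trees: \<open>free_part n\<close> is spanned by the trees
  with \<open>n\<close> leaves, and the whole direct sum by all trees.
\<close>

lemma free_part_induct [consumes 1, case_names zero add scale basis]:
  assumes "p \<in> free_part n"
    and "Q 0" "\<And>p q. Q p \<Longrightarrow> Q q \<Longrightarrow> Q (p + q)" "\<And>c p. Q p \<Longrightarrow> Q (free_scale c p)"
    and "\<And>t. leaves t = n \<Longrightarrow> Q (basis t)"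
  shows "Q p"
  by (rule free_induct_keys) (use assms in \<open>auto simp: free_part_def\<close>)

lemma free_induct [case_names zero add scale basis]:
  assumes "Q 0" "\<And>p q. Q p \<Longrightarrow> Q q \<Longrightarrow> Q (p + q)" "\<And>c p. Q p \<Longrightarrow> Q (free_scale c p)"
    and "\<And>t. Q (basis t)"
  shows "Q p"
  by (rule free_induct_keys) (use assms in auto)

lemma free_comp_mem:
  assumes "p \<in> free_part m" "q \<in> free_part n" "1 \<le> i" "i \<le> m"
  shows "free_comp p i q \<in> free_part (m + n - 1)"
  using assms(1)
proof (induction rule: free_part_induct)
  case (basis s)
  show ?case
    using assms(2)
    by (induction rule: free_part_induct) (use assms basis in \<open>auto simp: free_comp_basis leaves_graft\<close>)
qed auto

lemma free_sequential:
  assumes "f \<in> free_part l" "g \<in> free_part m" "h \<in> free_part n" "1 \<le> i" "i \<le> l" "1 \<le> j" "j \<le> m"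
  shows "free_comp f i (free_comp g j h) = free_comp (free_comp f i g) (i + j - 1) h"
  using assms(1)
proof (induction rule: free_part_induct)
  case (basis s)
  note s = this
  show ?case
    using assms(2)
  proof (induction rule: free_part_induct)
    case (basis t)
    note t = this
    show ?case
      using assms(3)
    proof (induction rule: free_part_induct)
      case (basis u)
      have "1 \<le> i + j - 1" "i + j - 1 \<le> leaves s + leaves t - 1" using assms s t by auto
      with s t assms show ?case by (simp add: free_comp_basis leaves_graft graft_sequential)
    qed auto
  qed auto
qed auto

lemma free_parallel:
  assumes "f \<in> free_part l" "g \<in> free_part m" "h \<in> free_part n" "1 \<le> i" "i < k" "k \<le> l"
  shows "free_comp (free_comp f i g) (k + m - 1) h = free_comp (free_comp f k h) i g"
  using assms(1)
proof (induction rule: free_part_induct)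
  case (basis s)
  note s = this
  show ?case
    using assms(2)
  proof (induction rule: free_part_induct)
    case (basis t)
    note t = this
    show ?case
      using assms(3)
    proof (induction rule: free_part_induct)
      case (basis u)
      have "1 \<le> k + leaves t - 1" "k + leaves t - 1 \<le> leaves s + leaves t - 1"
        "i \<le> leaves s + leaves u - 1"
        using assms s by auto
      with s t assms graft_parallel[of i k s t u] show ?case
        by (simp add: free_comp_basis leaves_graft)
    qed auto
  qed auto
qed auto

lemma free_unit_left: "free_comp (basis Leaf) 1 f = f"
  by (induction f rule: free_induct) (auto simp: free_comp_basis)

lemma free_unit_right:
  assumes "f \<in> free_part m" "1 \<le> i" "i \<le> m"
  shows "free_comp f i (basis Leaf) = f"
  using assms(1)
  by (induction rule: free_part_induct) (use assms in \<open>auto simp: free_comp_basis graft_Leaf_right\<close>)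

text \<open>
  The elements of an operadic ideal need not be homogeneous; this takes care of their components that
  are too small to be composed at \<open>i\<close>.
\<close>

lemma free_comp_out_of_range:
  assumes "p \<in> free_part m" "\<not> (1 \<le> i \<and> i \<le> m)"
  shows "free_comp p i q = 0"
  using assms(1)
proof (induction rule: free_part_induct)
  case (basis s)
  show ?case
    by (induction q rule: free_induct) (use basis assms in \<open>auto simp: free_comp_basis\<close>)
qed auto

text \<open>With induction on trees, this says that the corollas generate the free operad.\<close>

lemma basis_Node:
  "basis (Node g l r) =
     free_comp (free_comp (basis (Node g Leaf Leaf)) 2 (basis r)) 1 (basis l)"
  by (simp add: free_comp_basis)

definition lin_ext :: "('g tree \<Rightarrow> 'g tree \<Rightarrow>\<^sub>0 rat) \<Rightarrow> ('g tree \<Rightarrow>\<^sub>0 rat) \<Rightarrow> 'g tree \<Rightarrow>\<^sub>0 rat" where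
  "lin_ext f p = (\<Sum>t\<in>Poly_Mapping.keys p. free_scale (Poly_Mapping.lookup p t) (f t))"

lemma lin_ext_superset:
  assumes "finite A" "Poly_Mapping.keys p \<subseteq> A"
  shows "lin_ext f p = (\<Sum>t\<in>A. free_scale (Poly_Mapping.lookup p t) (f t))"
  unfolding lin_ext_def using assms
  by (intro sum.mono_neutral_left) (auto simp: in_keys_iff)

lemma lin_ext_zero [simp]: "lin_ext f 0 = 0"
  by (simp add: lin_ext_def)

lemma lin_ext_basis [simp]: "lin_ext f (basis t) = f t"
  by (simp add: lin_ext_def)

lemma lin_ext_add [simp]: "lin_ext f (p + q) = lin_ext f p + lin_ext f q"
proof -
  let ?A = "Poly_Mapping.keys p \<union> Poly_Mapping.keys q"
  have "finite ?A" by simp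
  moreover have "Poly_Mapping.keys (p + q) \<subseteq> ?A" by (rule keys_add)
  ultimately show ?thesis
    by (simp add: lin_ext_superset[of ?A] lookup_add free_scale_add_scalar sum.distrib)
qed

lemma lin_ext_scale [simp]: "lin_ext f (free_scale c p) = free_scale c (lin_ext f p)"
  unfolding lin_ext_superset[OF finite_keys keys_free_scale]
  by (simp add: lin_ext_def free_scale_sum)

lemma lin_ext_uminus [simp]: "lin_ext f (- p) = - lin_ext f p"
  using lin_ext_scale[of f "- 1" p] by (simp add: free_scale_minus_one)

lemma lin_ext_diff [simp]: "lin_ext f (p - q) = lin_ext f p - lin_ext f q"
  using lin_ext_add[of f p "- q"] by simp


section \<open>The rotation of a free operad\<close>

locale tree_rotation =
  fixes cyc :: "'g \<Rightarrow> 'g tree \<Rightarrow>\<^sub>0 rat"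
  assumes cyc_mem: "cyc g \<in> free_part 2"
begin

text \<open>
  The value on a node is forced by applying the two composition rules of an anticyclic operad to the
  composite in \<open>basis_Node\<close>, the value \<^term>\<open>cyc g\<close> on the corolla of \<open>g\<close> being prescribed.
\<close>

primrec rotate_tree :: "'g tree \<Rightarrow> 'g tree \<Rightarrow>\<^sub>0 rat" where
  "rotate_tree Leaf = - basis Leaf"
| "rotate_tree (Node g l r) =
     - free_comp (rotate_tree l) (leaves l) (free_comp (cyc g) 1 (basis r))"

abbreviation rotate :: "('g tree \<Rightarrow>\<^sub>0 rat) \<Rightarrow> 'g tree \<Rightarrow>\<^sub>0 rat" where
  "rotate \<equiv> lin_ext rotate_tree"

lemma cyc_comp_mem: "free_comp (cyc g) 1 (basis r) \<in> free_part (leaves r + 1)"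
  using free_comp_mem[OF cyc_mem, of "basis r" "leaves r" 1] by simp

lemma rotate_tree_mem: "rotate_tree t \<in> free_part (leaves t)"
proof (induction t)
  case (Node g l r)
  show ?case
    using free_comp_mem[OF Node.IH(1) cyc_comp_mem, of "leaves l"] by simp
qed simp

lemma rotate_mem: "p \<in> free_part n \<Longrightarrow> rotate p \<in> free_part n"
  by (induction rule: free_part_induct) (auto simp: rotate_tree_mem)

lemma rotate_generator: "rotate (basis (Node g Leaf Leaf)) = cyc g"
  using free_unit_left free_unit_right[OF cyc_mem, of 1] by simp

text \<open>
  If the leaf \<open>i\<close> lies in the left subtree, the recursion reduces the rule to parallel associativity;
  if it lies in the right subtree, to sequential associativity.
\<close>

lemma rotate_tree_graft:
  "\<lbrakk>2 \<le> i; i \<le> leaves s\<rbrakk> \<Longrightarrow>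
     rotate_tree (graft s i t) = free_comp (rotate_tree s) (i - 1) (basis t)"
proof (induction s arbitrary: i)
  case (Node g l r)
  let ?c = "free_comp (cyc g) 1 (basis r)"
  show ?case
  proof (cases "i \<le> leaves l")
    case True
    have "rotate_tree (graft (Node g l r) i t) =
        - free_comp (free_comp (rotate_tree l) (i - 1) (basis t)) (leaves l + leaves t - 1) ?c"
      using True Node by (simp add: leaves_graft)
    also have "\<dots> = - free_comp (free_comp (rotate_tree l) (leaves l) ?c) (i - 1) (basis t)"
      using free_parallel[OF rotate_tree_mem, of "basis t" "leaves t" ?c "leaves r + 1" "i - 1" "leaves l" l]
        True Node.prems cyc_comp_mem by simp
    finally show ?thesis by simp
  next
    case False
    define j where "j = i - leaves l"
    have j: "1 \<le> j" "j \<le> leaves r" "leaves l + j - 1 = i - 1" using False Node.prems by (auto simp: j_def)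
    have "rotate_tree (graft (Node g l r) i t) =
        - free_comp (rotate_tree l) (leaves l) (free_comp (cyc g) 1 (basis (graft r j t)))"
      using False by (simp add: j_def)
    also have "basis (graft r j t) = free_comp (basis r) j (basis t)"
      using j by (simp add: free_comp_basis)
    also have "free_comp (cyc g) 1 \<dots> = free_comp ?c j (basis t)"
      using free_sequential[OF cyc_mem, of "basis r" "leaves r" "basis t" "leaves t" 1 j] j by simp
    also have "free_comp (rotate_tree l) (leaves l) \<dots> =
        free_comp (free_comp (rotate_tree l) (leaves l) ?c) (i - 1) (basis t)"
      using free_sequential[OF rotate_tree_mem cyc_comp_mem, of "basis t" "leaves t" "leaves l" l j] j
      by simp
    finally show ?thesis by simp
  qed
qed simp

text \<open>
  The first leaf lies in the left subtree of every node on its path, so the induction runs down to the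
  single leaf, where the sign comes from \<open>\<tau>\<^sub>1 = - 1\<close>.
\<close>

lemma rotate_tree_graft_1:
  "rotate_tree (graft s 1 t) = - free_comp (rotate_tree t) (leaves t) (rotate_tree s)"
proof (induction s)
  case Leaf
  show ?case using free_unit_right[OF rotate_tree_mem, of "leaves t" t] by simp
next
  case (Node g l r)
  let ?c = "free_comp (cyc g) 1 (basis r)"
  have "rotate_tree (graft (Node g l r) 1 t) =
      free_comp (free_comp (rotate_tree t) (leaves t) (rotate_tree l)) (leaves l + leaves t - 1) ?c"
    using Node by (simp add: leaves_graft)
  also have "\<dots> = free_comp (rotate_tree t) (leaves t) (free_comp (rotate_tree l) (leaves l) ?c)"
    using free_sequential[OF rotate_tree_mem rotate_tree_mem cyc_comp_mem,
        of "leaves t" t "leaves l" l g r] by (simp add: add.commute)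
  finally show ?case by simp
qed

lemma rotate_comp:
  assumes "p \<in> free_part m" "2 \<le> i" "i \<le> m"
  shows "rotate (free_comp p i q) = free_comp (rotate p) (i - 1) q"
  using assms(1)
proof (induction rule: free_part_induct)
  case (basis s)
  show ?case
    by (induction q rule: free_induct)
      (use basis assms in \<open>auto simp: free_comp_basis rotate_tree_graft\<close>)
qed auto

lemma rotate_comp_1:
  assumes "p \<in> free_part m" "q \<in> free_part n"
  shows "rotate (free_comp p 1 q) = - free_comp (rotate q) n (rotate p)"
  using assms(1)
proof (induction rule: free_part_induct)
  case (basis s)
  show ?case
    using assms(2)
    by (induction rule: free_part_induct)
      (use basis assms rotate_tree_graft_1 in \<open>auto simp: free_comp_basis\<close>)
qed auto

lemma rotate_pow_mem: "p \<in> free_part n \<Longrightarrow> (rotate ^^ k) p \<in> free_part n"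
  by (induction k) (auto simp: rotate_mem)

lemma rotate_pow_add: "(rotate ^^ a) ((rotate ^^ b) p) = (rotate ^^ (a + b)) p"
  by (simp add: funpow_add)

lemma rotate_pow_uminus: "(rotate ^^ k) (- p) = - (rotate ^^ k) p"
  by (induction k) auto

lemma rotate_pow_comp:
  assumes "p \<in> free_part m" "i \<le> m"
  shows "k < i \<Longrightarrow> (rotate ^^ k) (free_comp p i q) = free_comp ((rotate ^^ k) p) (i - k) q"
proof (induction k)
  case (Suc k)
  then show ?case
    using rotate_comp[OF rotate_pow_mem[OF assms(1)], of "i - k" k q] assms by simp
qed simp

text \<open>
  The composition index decreases by one at each step. When it has reached 1, the next step exchanges
  the two factors.
\<close>

lemma rotate_pow_comp_swap:
  assumes "p \<in> free_part m" "q \<in> free_part n" "1 \<le> i" "i \<le> m"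
  shows "(rotate ^^ i) (free_comp p i q) = - free_comp (rotate q) n ((rotate ^^ i) p)"
proof -
  obtain k where k: "i = Suc k" using assms(3) by (cases i) auto
  have "(rotate ^^ i) (free_comp p i q) = rotate (free_comp ((rotate ^^ k) p) 1 q)"
    using rotate_pow_comp[OF assms(1,4), of k q] by (simp add: k)
  also have "\<dots> = - free_comp (rotate q) n ((rotate ^^ i) p)"
    using rotate_comp_1[OF rotate_pow_mem[OF assms(1)] assms(2)] by (simp add: k)
  finally show ?thesis .
qed

text \<open>
  After \<open>i\<close> steps the factors of \<open>p \<circ>\<^bsub>i\<^esub> q\<close> are exchanged, after \<open>n\<close> more steps they are exchanged back,
  and the remaining \<open>m - i\<close> steps return the index from \<open>m\<close> to \<open>i\<close>. The signs of the two exchanges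
  cancel, while \<open>p\<close> and \<open>q\<close> have each completed a full turn in their own arity.
\<close>

lemma rotate_order_comp:
  assumes p: "p \<in> free_part m" "(rotate ^^ (m + 1)) p = p"
    and q: "q \<in> free_part n" "(rotate ^^ (n + 1)) q = q"
    and i: "1 \<le> i" "i \<le> m" and "1 \<le> n"
  shows "(rotate ^^ (m + n)) (free_comp p i q) = free_comp p i q"
proof -
  have "(rotate ^^ (n + i)) (free_comp p i q) = - (rotate ^^ n) (free_comp (rotate q) n ((rotate ^^ i) p))"
    by (simp add: funpow_add rotate_pow_comp_swap[OF p(1) q(1) i] rotate_pow_uminus)
  also have "\<dots> = free_comp ((rotate ^^ (i + 1)) p) m ((rotate ^^ (n + 1)) q)"
    using rotate_pow_comp_swap[OF rotate_mem[OF q(1)] rotate_pow_mem[OF p(1), of i], of n] \<open>1 \<le> n\<close>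
    by (simp add: funpow_swap1)
  \<comment> \<open>Both factors are back in their places, with \<open>q\<close> attached to the last leaf.\<close>
  finally have half: "(rotate ^^ (n + i)) (free_comp p i q) = free_comp ((rotate ^^ (i + 1)) p) m q"
    using q(2) by simp
  have "(rotate ^^ (m + n)) (free_comp p i q) = (rotate ^^ (m - i)) ((rotate ^^ (n + i)) (free_comp p i q))"
    unfolding rotate_pow_add using i by (simp add: add.commute)
  also have "\<dots> = free_comp ((rotate ^^ (m - i)) ((rotate ^^ (i + 1)) p)) i q"
    unfolding half using rotate_pow_comp[OF rotate_pow_mem[OF p(1)], of m "m - i" "i + 1" q] i
    by simp
  also have "(rotate ^^ (m - i)) ((rotate ^^ (i + 1)) p) = (rotate ^^ (m + 1)) p"
    unfolding rotate_pow_add using i by (simp del: funpow.simps)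
  finally show ?thesis using p(2) by simp
qed

lemma rotate_order:
  assumes gen: "\<And>g. rotate (rotate (rotate (basis (Node g Leaf Leaf)))) = basis (Node g Leaf Leaf)"
    and "p \<in> free_part n"
  shows "(rotate ^^ (n + 1)) p = p"
proof -
  have tree: "(rotate ^^ (leaves t + 1)) (basis t) = basis t" for t
  proof (induction t)
    case (Node g l r)
    let ?g = "basis (Node g Leaf Leaf)" and ?l = "basis l" and ?r = "basis r"
    let ?p = "free_comp ?g 2 ?r"
    have p: "?p \<in> free_part (leaves r + 1)"
      using free_comp_mem[of ?g 2 ?r "leaves r" 2] by simp
    have "(rotate ^^ (2 + 1)) ?g = ?g"
      using gen[of g] by (simp del: lin_ext_basis add: eval_nat_numeral)
    from rotate_order_comp[OF _ this _ Node.IH(2), of 2]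
    have "(rotate ^^ (2 + leaves r)) ?p = ?p"
      by (simp del: lin_ext_basis funpow.simps)
    then have "(rotate ^^ (leaves r + 1 + 1)) ?p = ?p"
      by (simp only: add.commute[of 2] add.assoc one_add_one)
    from rotate_order_comp[OF p this _ Node.IH(1), of 1]
    have "(rotate ^^ (leaves r + 1 + leaves l)) (free_comp ?p 1 ?l) = free_comp ?p 1 ?l"
      by (simp del: lin_ext_basis funpow.simps)
    moreover have "leaves (Node g l r) + 1 = leaves r + 1 + leaves l"
      by simp
    moreover have "basis (Node g l r) = free_comp ?p 1 ?l"
      by (rule basis_Node)
    ultimately show ?case by (simp only:)
  qed simp
  have add: "(rotate ^^ k) (p + q) = (rotate ^^ k) p + (rotate ^^ k) q"
    and scale: "(rotate ^^ k) (free_scale c p) = free_scale c ((rotate ^^ k) p)"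
    and zero: "(rotate ^^ k) 0 = 0" for k p q c
    by (induction k) auto
  show ?thesis
    using assms(2)
    by (induction rule: free_part_induct)
      (use tree in \<open>auto simp: add scale zero simp del: funpow.simps\<close>)
qed

end


section \<open>Passing to a quotient\<close>

text \<open>
  The composition rule at the first leaf involves the arity of the inner factor, so it has no meaning
  for an inhomogeneous one. Since the elements of an operadic ideal need not be homogeneous,
  statements about them are made for each homogeneous component.
\<close>

definition component :: "nat \<Rightarrow> ('g tree \<Rightarrow>\<^sub>0 rat) \<Rightarrow> 'g tree \<Rightarrow>\<^sub>0 rat" where
  "component n = lin_ext (\<lambda>t. if leaves t = n then basis t else 0)"

lemma component_zero [simp]: "component n 0 = 0"
  by (simp add: component_def)

lemma component_mem: "component n p \<in> free_part n"
  unfolding component_def by (induction p rule: free_induct) auto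

lemma component_eq: "p \<in> free_part m \<Longrightarrow> component n p = (if m = n then p else 0)"
  unfolding component_def by (induction rule: free_part_induct) auto

text \<open>
  If \<open>t\<close> has more than \<open>n\<close> leaves, the truncated difference is 0 and both sides vanish, as no
  tree has 0 leaves.
\<close>

lemma component_comp_basis_right:
  "component n (free_comp p i (basis t)) = free_comp (component (n + 1 - leaves t) p) i (basis t)"
proof (induction p rule: free_induct)
  case (basis s)
  have "leaves s + leaves t - 1 = n \<longleftrightarrow> leaves s = n + 1 - leaves t"
    using leaves_pos(1)[of s] leaves_pos(1)[of t] by linarith
  then show ?case by (auto simp: component_def free_comp_basis leaves_graft)
qed (auto simp: component_def)

lemma component_comp_basis_left:
  "component n (free_comp (basis s) i q) = free_comp (basis s) i (component (n + 1 - leaves s) q)"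
proof (induction q rule: free_induct)
  case (basis t)
  have "leaves s + leaves t - 1 = n \<longleftrightarrow> leaves t = n + 1 - leaves s"
    using leaves_pos(1)[of s] leaves_pos(1)[of t] by linarith
  then show ?case by (auto simp: component_def free_comp_basis leaves_graft)
qed (auto simp: component_def)

text \<open>An operadic ideal with homogeneous generators is graded.\<close>

lemma component_ideal:
  assumes R: "\<And>r. r \<in> R \<Longrightarrow> \<exists>k. r \<in> free_part k" and "p \<in> operadic_ideal R"
  shows "component n p \<in> operadic_ideal R"
  using assms(2)
proof (induction arbitrary: n)
  case (ideal_gen r)
  then obtain k where "r \<in> free_part k" using R by blast
  with ideal_gen show ?case by (simp add: component_eq operadic_ideal.intros)
next
  case (ideal_comp_left p i q)
  show ?case
  proof (induction q rule: free_induct)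
    case (basis t)
    show ?case
      by (simp add: component_comp_basis_right operadic_ideal.ideal_comp_left ideal_comp_left.IH)
  qed (auto simp: component_def intro: operadic_ideal.intros)
next
  case (ideal_comp_right q p i)
  show ?case
  proof (induction p rule: free_induct)
    case (basis s)
    show ?case
      by (simp add: component_comp_basis_left operadic_ideal.ideal_comp_right ideal_comp_right.IH)
  qed (auto simp: component_def intro: operadic_ideal.intros)
qed (auto simp: component_def intro: operadic_ideal.intros)

context tree_rotation
begin

text \<open>
  The composition rules express the image of a composite through the image of the factor in the ideal,
  except when that factor is the inner one and is composed at \<open>i \<ge> 2\<close>: then it appears unchanged, and
  what is needed is that its components lie in the ideal.
\<close>

lemma rotate_ideal:
  assumes R: "\<And>r. r \<in> R \<Longrightarrow> \<exists>k. r \<in> free_part k \<and> rotate r \<in> operadic_ideal R"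
    and "p \<in> operadic_ideal R"
  shows "rotate (component n p) \<in> operadic_ideal R"
  using assms(2)
proof (induction arbitrary: n)
  case (ideal_gen r)
  then show ?case using R by (fastforce simp: component_eq ideal_zero)
next
  case (ideal_comp_left p i q)
  show ?case
  proof (induction q rule: free_induct)
    case (basis t)
    let ?p = "component (n + 1 - leaves t) p"
    consider "i = 1" | "2 \<le> i" "i \<le> n + 1 - leaves t" | "\<not> (1 \<le> i \<and> i \<le> n + 1 - leaves t)"
      by linarith
    then show ?case
    proof cases
      case 1
      then show ?thesis
        using rotate_comp_1[OF component_mem, of "basis t" "leaves t"]
        by (simp add: component_comp_basis_right ideal_uminus operadic_ideal.ideal_comp_right
            ideal_comp_left.IH)
    next
      case 2
      then show ?thesis
        by (simp add: component_comp_basis_right rotate_comp[OF component_mem]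
            operadic_ideal.ideal_comp_left ideal_comp_left.IH)
    next
      case 3
      then show ?thesis
        by (simp add: component_comp_basis_right free_comp_out_of_range[OF component_mem] ideal_zero)
    qed
  qed (auto simp: component_def intro: operadic_ideal.intros)
next
  case (ideal_comp_right q p i)
  show ?case
  proof (induction p rule: free_induct)
    case (basis s)
    consider "i = 1" | "2 \<le> i" "i \<le> leaves s" | "\<not> (1 \<le> i \<and> i \<le> leaves s)"
      by linarith
    then show ?case
    proof cases
      case 1
      then show ?thesis
        using rotate_comp_1[OF _ component_mem, of "basis s" "leaves s"]
        by (simp add: component_comp_basis_left ideal_uminus operadic_ideal.ideal_comp_left
            ideal_comp_right.IH)
    next
      case 2
      moreover have "component (n + 1 - leaves s) q \<in> operadic_ideal R"
        by (rule component_ideal[OF _ ideal_comp_right.hyps]) (use R in blast)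
      ultimately show ?thesis
        using rotate_comp[of "basis s" "leaves s" i]
        by (simp add: component_comp_basis_left operadic_ideal.ideal_comp_right)
    next
      case 3
      then show ?thesis
        using free_comp_out_of_range[of "basis s" "leaves s" i]
        by (simp add: component_comp_basis_left ideal_zero)
    qed
  qed (auto simp: component_def intro: operadic_ideal.intros)
qed (auto simp: component_def intro: operadic_ideal.intros)

end


section \<open>The dendriform operad\<close>

lemma Dend_cases:
  assumes "x \<in> Dend n"
  obtains p where "p \<in> free_part n" "x = abs_dend p"
  using assms by (auto simp: Dend_def)

lemma abs_dend_mem: "p \<in> free_part n \<Longrightarrow> abs_dend p \<in> Dend n"
  by (simp add: Dend_def)

lemmas dend_abs_simps =
  zero_dend.abs_eq[symmetric] plus_dend.abs_eq uminus_dend.abs_eq dend_scale.abs_eq dend_comp.abs_eq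
  dend_unit.abs_eq

lemma ns_operad_Dend: "ns_operad dend_scale Dend dend_comp dend_unit"
proof -
  have scale: "vector_space dend_scale"
  proof
    fix a b :: rat and x y :: dend
    obtain p q where "x = abs_dend p" "y = abs_dend q" by (metis Quotient_abs_rep Quotient_dend)
    then show "dend_scale a (x + y) = dend_scale a x + dend_scale a y"
      "dend_scale (a + b) x = dend_scale a x + dend_scale b x"
      "dend_scale a (dend_scale b x) = dend_scale (a * b) x"
      "dend_scale 1 x = x"
      by (simp_all add: dend_abs_simps free_scale_add_scalar)
  qed
  interpret vector_space dend_scale by (rule scale)
  show ?thesis
  proof (unfold_locales, goal_cases)
    case (1 n)
    show ?case
    proof (rule subspaceI)
      show "0 \<in> Dend n"
        unfolding zero_dend.abs_eq by (rule abs_dend_mem) simp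
    next
      fix x y assume "x \<in> Dend n" "y \<in> Dend n"
      then show "x + y \<in> Dend n"
        by (elim Dend_cases) (auto simp: dend_abs_simps intro!: abs_dend_mem)
    next
      fix c x assume "x \<in> Dend n"
      then show "dend_scale c x \<in> Dend n"
        by (elim Dend_cases) (auto simp: dend_abs_simps intro!: abs_dend_mem)
    qed
  next
    case 2
    show ?case unfolding dend_unit.abs_eq by (rule abs_dend_mem) simp
  next
    case (3 f m g n i)
    then obtain p q where pq: "p \<in> free_part m" "f = abs_dend p" "q \<in> free_part n" "g = abs_dend q"
      by (elim Dend_cases)
    show ?case
      unfolding pq dend_abs_simps by (intro abs_dend_mem free_comp_mem pq 3)
  next
    case 8
    then show ?case by (elim Dend_cases) (simp add: dend_abs_simps free_unit_left[simplified])
  next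
    case 9
    then show ?case by (elim Dend_cases) (simp add: dend_abs_simps free_unit_right)
  next
    case (10 f l g m h n i j)
    then show ?case 
      by (elim Dend_cases) (simp add: dend_abs_simps free_sequential[of _ l _ m _ n i j] del: One_nat_def)
  next
    case (11 f l g m h n i k)
    then show ?case 
      by (elim Dend_cases) (simp add: dend_abs_simps free_parallel[of _ l _ m _ n i k] del: One_nat_def)
  qed (elim Dend_cases, simp add: dend_abs_simps)+
qed

text \<open>The prescribed \<open>\<tau>\<^sub>2\<close>, lifted to the free operad; it is an action of the cyclic group of order 3.\<close>

definition dend_cyc :: "dend_gen \<Rightarrow> dend_gen tree \<Rightarrow>\<^sub>0 rat" where
  "dend_cyc g = (case g of
       Succ \<Rightarrow> basis (Node Prec Leaf Leaf)
     | Prec \<Rightarrow> - basis (Node Prec Leaf Leaf) - basis (Node Succ Leaf Leaf))"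

interpretation dend: tree_rotation dend_cyc
  by standard (simp add: dend_cyc_def split: dend_gen.split)

lemma dend_rotate_generator_order:
  "dend.rotate (dend.rotate (dend.rotate (basis (Node g Leaf Leaf)))) = basis (Node g Leaf Leaf)"
  unfolding dend.rotate_generator
  by (cases g) (simp_all add: dend_cyc_def dend.rotate_generator del: lin_ext_basis)

lemma dend_relations_homogeneous: "r \<in> dend_relations \<Longrightarrow> r \<in> free_part 3"
  by (auto simp: dend_relations_def)

text \<open>
  Up to sign, the second relation is the image of the third and the first that of the second. The span
  of the three relations is therefore stable once the image of the first is known to lie in it.
\<close>

lemma dend_rotate_relation:
  assumes "r \<in> dend_relations"
  shows "dend.rotate r \<in> operadic_ideal dend_relations"
proof -
  define R1 R2 R3 :: "dend_gen tree \<Rightarrow>\<^sub>0 rat" where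
    "R1 = basis (Node Prec (Node Prec Leaf Leaf) Leaf)
       - (basis (Node Prec Leaf (Node Prec Leaf Leaf))
          + basis (Node Prec Leaf (Node Succ Leaf Leaf)))" and
    "R2 = basis (Node Succ Leaf (Node Prec Leaf Leaf))
       - basis (Node Prec (Node Succ Leaf Leaf) Leaf)" and
    "R3 = basis (Node Succ Leaf (Node Succ Leaf Leaf))
       - (basis (Node Succ (Node Succ Leaf Leaf) Leaf)
          + basis (Node Succ (Node Prec Leaf Leaf) Leaf))"
  note R_defs = R1_def R2_def R3_def
  have R: "dend_relations = {R1, R2, R3}" by (simp add: dend_relations_def R_defs)
  have "dend.rotate R1 = R1 - R2 - R3" "dend.rotate R2 = R1" "dend.rotate R3 = - R2"
    by (simp_all add: R_defs dend_cyc_def free_comp_basis free_comp_diff_left free_comp_diff_right)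
  moreover have "R1 \<in> operadic_ideal dend_relations" "R2 \<in> operadic_ideal dend_relations"
    "R3 \<in> operadic_ideal dend_relations"
    by (simp_all add: R ideal_gen)
  ultimately show ?thesis
    using assms by (auto simp: R intro!: ideal_diff ideal_uminus)
qed

text \<open>
  In arity \<open>n\<close> the map is defined on all of the direct sum by first projecting to the component of
  arity \<open>n\<close>. This makes it well defined on classes by \<open>rotate_ideal\<close>, whichever representatives
  are chosen.
\<close>

lift_definition dend_rotate :: "nat \<Rightarrow> dend \<Rightarrow> dend" is "\<lambda>n p. dend.rotate (component n p)"
proof -
  fix n and p q :: "dend_gen tree \<Rightarrow>\<^sub>0 rat"
  assume "dend_rel p q"
  then have "dend.rotate (component n (p - q)) \<in> operadic_ideal dend_relations"
    unfolding dend_rel_def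
    by (rule dend.rotate_ideal[rotated]) (use dend_rotate_relation dend_relations_homogeneous in blast)
  then show "dend_rel (dend.rotate (component n p)) (dend.rotate (component n q))"
    by (simp add: dend_rel_def component_def)
qed

lemma dend_rotate_abs:
  "p \<in> free_part n \<Longrightarrow> dend_rotate n (abs_dend p) = abs_dend (dend.rotate p)"
  by (simp add: dend_rotate.abs_eq component_eq)

lemma dend_rotate_pow_abs:
  "p \<in> free_part n \<Longrightarrow> (dend_rotate n ^^ k) (abs_dend p) = abs_dend ((dend.rotate ^^ k) p)"
  by (induction k) (simp_all add: dend_rotate_abs dend.rotate_pow_mem)

lemma dend_rotate_mem: "x \<in> Dend n \<Longrightarrow> dend_rotate n x \<in> Dend n"
  by (elim Dend_cases) (simp add: dend_rotate_abs abs_dend_mem dend.rotate_mem)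

lemma ns_anticyclic_operad_Dend:
  "ns_anticyclic_operad dend_scale Dend dend_comp dend_unit dend_rotate"
proof -
  interpret ns_operad dend_scale Dend dend_comp dend_unit by (rule ns_operad_Dend)
  show ?thesis
  proof (unfold_locales, goal_cases)
    case 1
    then show ?case by (simp add: dend_rotate_mem)
  next
    case 2
    then show ?case by (elim Dend_cases) (simp add: dend_abs_simps dend_rotate_abs)
  next
    case 3
    then show ?case by (elim Dend_cases) (simp add: dend_abs_simps dend_rotate_abs)
  next
    case (4 n f)
    then obtain p where p: "p \<in> free_part n" "f = abs_dend p" by (elim Dend_cases)
    then show ?case
      using dend.rotate_order[OF dend_rotate_generator_order p(1)]
      by (simp add: dend_rotate_pow_abs del: funpow.simps)
  next
    case 5
    show ?case by (simp add: dend_abs_simps dend_rotate_abs)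
  next
    case (6 m n f g i)
    then obtain p q where pq: "p \<in> free_part m" "f = abs_dend p" "q \<in> free_part n" "g = abs_dend q"
      by (elim Dend_cases)
    with 6 free_comp_mem[OF pq(1,3), of i] dend.rotate_comp[OF pq(1), of i] show ?case
      by (simp add: dend_abs_simps dend_rotate_abs)
  next
    case (7 m n f g)
    then obtain p q where pq: "p \<in> free_part m" "f = abs_dend p" "q \<in> free_part n" "g = abs_dend q"
      by (elim Dend_cases)
    with 7 free_comp_mem[OF pq(1,3), of 1] dend.rotate_comp_1[OF pq(1,3)] show ?case
      by (simp add: dend_abs_simps dend_rotate_abs)
  qed
qed

lemma dend_rotate_generators:
  "dend_rotate 2 dend_succ = dend_prec"
  "dend_rotate 2 dend_prec = - dend_prec - dend_succ"
  by (simp_all add: dend_succ.abs_eq dend_prec.abs_eq dend_rotate_abs dend.rotate_generator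
      dend_cyc_def uminus_dend.abs_eq minus_dend.abs_eq del: lin_ext_basis)

lemma dend_rotate_1: "x \<in> Dend 1 \<Longrightarrow> dend_rotate 1 x = - x"
proof (elim Dend_cases)
  fix p :: "dend_gen tree \<Rightarrow>\<^sub>0 rat"
  assume p: "p \<in> free_part 1" and x: "x = abs_dend p"
  from p have "dend.rotate p = - p"
  proof (induction rule: free_part_induct)
    case (basis t)
    then have "t = Leaf"
      by (cases t) (auto simp: add_is_1)
    then show ?case by simp
  qed auto
  with p x show ?thesis by (simp add: dend_rotate_abs uminus_dend.abs_eq)
qed

text \<open>
  The classes of trees span \<^term>\<open>Dend n\<close>, and the composition rules determine the value on a tree
  from the values on its left subtree and on the generator at its root.
\<close>

lemma anticyclic_Dend_unique:
  assumes "ns_anticyclic_operad dend_scale Dend dend_comp dend_unit \<sigma>"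
    and "ns_anticyclic_operad dend_scale Dend dend_comp dend_unit \<tau>"
    and gen: "\<sigma> 2 dend_succ = \<tau> 2 dend_succ" "\<sigma> 2 dend_prec = \<tau> 2 dend_prec"
    and "1 \<le> n" "x \<in> Dend n"
  shows "\<sigma> n x = \<tau> n x"
proof -
  interpret S: ns_anticyclic_operad dend_scale Dend dend_comp dend_unit \<sigma> by fact
  interpret T: ns_anticyclic_operad dend_scale Dend dend_comp dend_unit \<tau> by fact
  have mem: "abs_dend (basis t) \<in> Dend (leaves t)" for t
    by (simp add: abs_dend_mem)
  have tree: "\<sigma> (leaves t) (abs_dend (basis t)) = \<tau> (leaves t) (abs_dend (basis t))" for t
  proof (induction t)
    case Leaf
    show ?case using S.tau_unit T.tau_unit by (simp add: dend_unit.abs_eq)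
  next
    case (Node g l r)
    let ?g = "abs_dend (basis (Node g Leaf Leaf))"
    let ?l = "abs_dend (basis l)" and ?r = "abs_dend (basis r)"
    let ?p = "dend_comp ?g 2 ?r"
    have g: "?g \<in> Dend 2" using mem[of "Node g Leaf Leaf"] by (simp add: numeral_2_eq_2)
    have p: "?p \<in> Dend (leaves r + 1)"
      using S.pcomp_mem[OF g mem[of r], of 2] by simp
    have Node: "abs_dend (basis (Node g l r)) = dend_comp ?p 1 ?l"
      by (simp add: dend_abs_simps free_comp_basis)
    have "\<sigma> 2 ?g = \<tau> 2 ?g"
      using gen by (cases g) (simp_all add: dend_succ.abs_eq dend_prec.abs_eq)
    then have "\<sigma> (leaves r + 1) ?p = \<tau> (leaves r + 1) ?p"
      using S.tau_pcomp[OF _ _ g mem[of r], of 2] T.tau_pcomp[OF _ _ g mem[of r], of 2] by simp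
    then show ?case
      using S.tau_pcomp_1[OF _ _ p mem[of l]] T.tau_pcomp_1[OF _ _ p mem[of l]] Node.IH(1)
      by (simp add: Node add.commute)
  qed
  \<comment> \<open>The membership is carried along because additivity of the maps is assumed on \<open>Dend n\<close> only.\<close>
  have "\<sigma> n (abs_dend p) = \<tau> n (abs_dend p) \<and> p \<in> free_part n" if "p \<in> free_part n" for p
    using that
  proof (induction rule: free_part_induct)
    case zero
    have "\<sigma> n 0 = 0" "\<tau> n 0 = 0"
      using S.tau_add[of n 0 0] T.tau_add[of n 0 0] \<open>1 \<le> n\<close> S.subspace_0[OF S.subspace_P] by auto
    then show ?case by (simp add: zero_dend.abs_eq[symmetric])
  next
    case (add p q)
    then show ?case
      using S.tau_add T.tau_add \<open>1 \<le> n\<close> by (simp flip: plus_dend.abs_eq add: abs_dend_mem)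
  next
    case (scale c p)
    then show ?case
      using S.tau_scale T.tau_scale \<open>1 \<le> n\<close> by (simp flip: dend_scale.abs_eq add: abs_dend_mem)
  next
    case (basis t)
    then show ?case using tree[of t] by simp
  qed
  with \<open>x \<in> Dend n\<close> show ?thesis by (auto elim: Dend_cases)
qed

theorem theorem4p1:
  "\<exists>!\<tau>. \<tau> \<in> (\<Pi>\<^sub>E n\<in>{1..}. Dend n \<rightarrow>\<^sub>E Dend n) \<and>
        (\<forall>x\<in>Dend 1. \<tau> 1 x = - x) \<and>
        \<tau> 2 dend_succ = dend_prec \<and>
        \<tau> 2 dend_prec = - dend_prec - dend_succ \<and>
        ns_anticyclic_operad dend_scale Dend dend_comp dend_unit \<tau>"
proof (rule ex_ex1I)
  \<comment> \<open>The maps are cut down to the components \<open>Dend n\<close>, so that the family is unique as a function.\<close>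
  define \<rho> where "\<rho> = (\<lambda>n\<in>{1..}. \<lambda>x\<in>Dend n. dend_rotate n x)"
  interpret ns_anticyclic_operad dend_scale Dend dend_comp dend_unit dend_rotate
    by (rule ns_anticyclic_operad_Dend)
  have \<rho>: "\<rho> n x = dend_rotate n x" if "1 \<le> n" "x \<in> Dend n" for n x
    using that by (simp add: \<rho>_def)
  have \<rho>_pow: "(\<rho> n ^^ k) x = (dend_rotate n ^^ k) x \<and> (dend_rotate n ^^ k) x \<in> Dend n"
    if "1 \<le> n" "x \<in> Dend n" for n x k
    using that by (induction k) (simp_all add: \<rho> dend_rotate_mem)
  have gen: "dend_succ \<in> Dend 2" "dend_prec \<in> Dend 2"
    by (simp_all add: dend_succ.abs_eq dend_prec.abs_eq abs_dend_mem)
  have "ns_anticyclic_operad dend_scale Dend dend_comp dend_unit \<rho>"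
  proof (unfold_locales, goal_cases)
    case 1
    then show ?case by (simp add: \<rho> tau_mem)
  next
    case 2
    then show ?case by (simp add: \<rho> tau_add subspace_add[OF subspace_P])
  next
    case 3
    then show ?case by (simp add: \<rho> tau_scale subspace_scale[OF subspace_P])
  next
    case 4
    then show ?case using \<rho>_pow tau_order by metis
  next
    case 5
    show ?case by (metis \<rho> tau_unit unit_mem order.refl)
  next
    case (6 m n f g i)
    then show ?case using pcomp_mem[of f m g n i] tau_pcomp[of m n f g i] by (simp add: \<rho>)
  next
    case (7 m n f g)
    then show ?case using pcomp_mem[of f m g n 1] tau_pcomp_1[of m n f g] by (simp add: \<rho>)
  qed
  moreover have "\<rho> 1 x = - x" if "x \<in> Dend 1" for x
    using that by (simp add: \<rho> dend_rotate_1 del: One_nat_def)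
  ultimately show "\<exists>\<tau>. \<tau> \<in> (\<Pi>\<^sub>E n\<in>{1..}. Dend n \<rightarrow>\<^sub>E Dend n) \<and>
      (\<forall>x\<in>Dend 1. \<tau> 1 x = - x) \<and> \<tau> 2 dend_succ = dend_prec \<and>
      \<tau> 2 dend_prec = - dend_prec - dend_succ \<and>
      ns_anticyclic_operad dend_scale Dend dend_comp dend_unit \<tau>"
    by (intro exI[of _ \<rho>]) (auto simp: \<rho> gen dend_rotate_generators \<rho>_def dend_rotate_mem)
next
  fix \<sigma> \<tau>
  assume *: "\<sigma> \<in> (\<Pi>\<^sub>E n\<in>{1..}. Dend n \<rightarrow>\<^sub>E Dend n) \<and>
      (\<forall>x\<in>Dend 1. \<sigma> 1 x = - x) \<and> \<sigma> 2 dend_succ = dend_prec \<and>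
      \<sigma> 2 dend_prec = - dend_prec - dend_succ \<and>
      ns_anticyclic_operad dend_scale Dend dend_comp dend_unit \<sigma>"
    "\<tau> \<in> (\<Pi>\<^sub>E n\<in>{1..}. Dend n \<rightarrow>\<^sub>E Dend n) \<and>
      (\<forall>x\<in>Dend 1. \<tau> 1 x = - x) \<and> \<tau> 2 dend_succ = dend_prec \<and>
      \<tau> 2 dend_prec = - dend_prec - dend_succ \<and>
      ns_anticyclic_operad dend_scale Dend dend_comp dend_unit \<tau>"
  show "\<sigma> = \<tau>"
  proof (rule PiE_ext)
    show "\<sigma> \<in> (\<Pi>\<^sub>E n\<in>{1..}. Dend n \<rightarrow>\<^sub>E Dend n)" "\<tau> \<in> (\<Pi>\<^sub>E n\<in>{1..}. Dend n \<rightarrow>\<^sub>E Dend n)"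
      using * by auto
    fix n :: nat assume n: "n \<in> {1..}"
    show "\<sigma> n = \<tau> n"
    proof (rule PiE_ext)
      show "\<sigma> n \<in> Dend n \<rightarrow>\<^sub>E Dend n" "\<tau> n \<in> Dend n \<rightarrow>\<^sub>E Dend n"
        using * n by auto
      show "\<sigma> n x = \<tau> n x" if "x \<in> Dend n" for x
        by (rule anticyclic_Dend_unique) (use * n that in auto)
    qed
  qed
qed

end
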